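(* Let $G$ be a group generated as a monoid by a subset $A\subseteq G$ that is closed under $G$-conjugation, and let $c\in G$ with $n=\ell_A(c)$. Suppose that $\mathrm{Red}_A(c)$ is finite, that $\mathcal{P}_c(G,A)$ is chain-connected, and that it admits a $c$-compatible order of $A_c$. Then the Hurwitz action of $B_n$ on $\mathrm{Red}_A(c)$ is transitive.
   Context: For $x\in G$, $\ell_A(x)$ is the least $k\ge 0$ such that $x=a_1\cdots a_k$ with all $a_i\in A$. Such a factorization with $k=\ell_A(x)$ is a reduced $A$-factorization; $\mathrm{Red}_A(x)$ is the set of these, written as tuples. The $A$-prefix order is $x\le_A y$ iff $\ell_A(x)+\ell_A(x^{-1}y)=\ell_A(y)$. The factorization poset $\mathcal{P}_c(G,A)$ is $[e,c]_A=\{x: e\le_A x\le_A c\}$ with the order $\le_A$. $A_c=\{a\in A: a\le_A c\}$. A linear order $\prec$ on $A_c$ is $c$-compatible if every $g\le_A c$ with $\ell_A(g)=2$ has exactly one reduced $A$-factorization $(a,b)$ with $a\preceq b$. The chain graph of a finite bounded graded poset has the maximal chains as vertices, two being adjacent when they differ in exactly one element; the poset is chain-connected if this graph is connected. The Hurwitz action of the braid group $B_n=\langle\sigma_1,\dots,\sigma_{n-1}\rangle$ on $\mathrm{Red}_A(c)$ is given by $\sigma_i\cdot(a_1,\dots,a_n)=(a_1,\dots,a_{i-1},a_{i+1},a_{i+1}^{-1}a_ia_{i+1},a_{i+2},\dots,a_n)$. *)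

theory Defs
  imports "HOL-Algebra.Group_Action" "Graph_Theory.Digraph_Component"
begin

section \<open>Factorizations\<close>

definition monoid_generated :: "('a, 'b) monoid_scheme \<Rightarrow> 'a set \<Rightarrow> 'a set" where
  "monoid_generated G A = \<Inter>{H. submonoid H G \<and> A \<subseteq> H}"

definition word_prod :: "('a, 'b) monoid_scheme \<Rightarrow> 'a list \<Rightarrow> 'a" where
  "word_prod G as = foldr (\<otimes>\<^bsub>G\<^esub>) as \<one>\<^bsub>G\<^esub>"

text \<open>
  The minimum is attained only for products of elements of \<open>A\<close>; it is used for
  groups that are generated by \<open>A\<close> as monoids, where every element is such a product.
\<close>

definition wlen :: "('a, 'b) monoid_scheme \<Rightarrow> 'a set \<Rightarrow> 'a \<Rightarrow> nat" where
  "wlen G A x = (LEAST k. \<exists>as. set as \<subseteq> A \<and> length as = k \<and> word_prod G as = x)"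

definition Red :: "('a, 'b) monoid_scheme \<Rightarrow> 'a set \<Rightarrow> 'a \<Rightarrow> 'a list set" where
  "Red G A x = {as. set as \<subseteq> A \<and> word_prod G as = x \<and> length as = wlen G A x}"

definition prefix_le :: "('a, 'b) monoid_scheme \<Rightarrow> 'a set \<Rightarrow> 'a \<Rightarrow> 'a \<Rightarrow> bool" where
  "prefix_le G A x y \<longleftrightarrow> wlen G A x + wlen G A (inv\<^bsub>G\<^esub> x \<otimes>\<^bsub>G\<^esub> y) = wlen G A y"

definition factorization_poset :: "('a, 'b) monoid_scheme \<Rightarrow> 'a set \<Rightarrow> 'a \<Rightarrow> 'a gorder" where
  "factorization_poset G A c =
    \<lparr>carrier = {x \<in> carrier G. prefix_le G A \<one>\<^bsub>G\<^esub> x \<and> prefix_le G A x c},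
     eq = (=),
     le = prefix_le G A\<rparr>"

definition atoms_below :: "('a, 'b) monoid_scheme \<Rightarrow> 'a set \<Rightarrow> 'a \<Rightarrow> 'a set" where
  "atoms_below G A c = {a \<in> A. prefix_le G A a c}"

text \<open>The relation \<open>r\<close> is the reflexive version of the linear order.\<close>

definition compatible_order ::
    "('a, 'b) monoid_scheme \<Rightarrow> 'a set \<Rightarrow> 'a \<Rightarrow> ('a \<times> 'a) set \<Rightarrow> bool" where
  "compatible_order G A c r \<longleftrightarrow>
    linear_order_on (atoms_below G A c) r \<and>
    (\<forall>g \<in> carrier G. prefix_le G A g c \<and> wlen G A g = 2 \<longrightarrow>
      (\<exists>!p. [fst p, snd p] \<in> Red G A g \<and> p \<in> r))"


section \<open>Chain graphs\<close>

text \<open>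
  In a finite graded poset with bounds all maximal chains have the same cardinality, so two of
  them differ in exactly one element iff each has exactly one element outside the other.
\<close>

definition chain_graph :: "('a, 'b) gorder_scheme \<Rightarrow> 'a set pair_pre_digraph" where
  "chain_graph P =
    \<lparr>pverts = {C. pred_on.maxchain (carrier P) (le P) C},
     parcs = {(C, D). pred_on.maxchain (carrier P) (le P) C \<and>
                      pred_on.maxchain (carrier P) (le P) D \<and>
                      card (C - D) = 1 \<and> card (D - C) = 1}\<rparr>"

definition chain_connected :: "('a, 'b) gorder_scheme \<Rightarrow> bool" where
  "chain_connected P \<longleftrightarrow> Digraph_Component.connected (with_proj (chain_graph P))"


section \<open>The braid group\<close>

text \<open>
  \<open>B\<^sub>n\<close> is given by Artin's presentation with generators \<open>\<sigma>\<^sub>1, \<dots>, \<sigma>\<^sub>n\<^sub>-\<^sub>1\<close>, as the set of words in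
  the letters \<open>\<sigma>\<^sub>i = Pos i\<close> and \<open>\<sigma>\<^sub>i\<^sup>-\<^sup>1 = Neg i\<close> modulo the congruence generated by free
  cancellation and the braid relations. For \<open>n \<le> 1\<close> it is trivial.
\<close>

datatype braid_letter = Pos nat | Neg nat

definition braid_words :: "nat \<Rightarrow> braid_letter list set" where
  "braid_words n = lists (Pos ` {1..<n} \<union> Neg ` {1..<n})"

inductive braid_eq :: "nat \<Rightarrow> braid_letter list \<Rightarrow> braid_letter list \<Rightarrow> bool" for n where
  refl: "w \<in> braid_words n \<Longrightarrow> braid_eq n w w"
| sym: "braid_eq n u v \<Longrightarrow> braid_eq n v u"
| trans: "braid_eq n u v \<Longrightarrow> braid_eq n v w \<Longrightarrow> braid_eq n u w"
| append: "braid_eq n u u' \<Longrightarrow> braid_eq n v v' \<Longrightarrow> braid_eq n (u @ v) (u' @ v')"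
| Pos_Neg: "i \<in> {1..<n} \<Longrightarrow> braid_eq n [Pos i, Neg i] []"
| Neg_Pos: "i \<in> {1..<n} \<Longrightarrow> braid_eq n [Neg i, Pos i] []"
| braid: "i \<in> {1..<n} \<Longrightarrow> Suc i \<in> {1..<n} \<Longrightarrow>
    braid_eq n [Pos i, Pos (Suc i), Pos i] [Pos (Suc i), Pos i, Pos (Suc i)]"
| comm: "i \<in> {1..<n} \<Longrightarrow> j \<in> {1..<n} \<Longrightarrow> i + 2 \<le> j \<Longrightarrow>
    braid_eq n [Pos i, Pos j] [Pos j, Pos i]"

definition braid_rel :: "nat \<Rightarrow> (braid_letter list \<times> braid_letter list) set" where
  "braid_rel n = {(u, v). braid_eq n u v}"

definition braid_group :: "nat \<Rightarrow> braid_letter list set monoid" where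
  "braid_group n =
    \<lparr>carrier = braid_words n // braid_rel n,
     monoid.mult = (\<lambda>X Y. \<Union>u \<in> X. \<Union>v \<in> Y. braid_rel n `` {u @ v}),
     one = braid_rel n `` {[]}\<rparr>"


section \<open>The Hurwitz action\<close>

text \<open>
  Tuples are indexed from \<open>1\<close> in the formula for \<open>\<sigma>\<^sub>i\<close> and lists from \<open>0\<close>, so \<open>\<sigma>\<^sub>i\<close> changes the
  list entries \<open>i - 1\<close> and \<open>i\<close>. Words act from the left.
\<close>

fun hurwitz_letter ::
    "('a, 'b) monoid_scheme \<Rightarrow> braid_letter \<Rightarrow> 'a list \<Rightarrow> 'a list" where
  "hurwitz_letter G (Pos i) as =
    as[i - 1 := as ! i, i := inv\<^bsub>G\<^esub> (as ! i) \<otimes>\<^bsub>G\<^esub> as ! (i - 1) \<otimes>\<^bsub>G\<^esub> as ! i]"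
| "hurwitz_letter G (Neg i) as =
    as[i - 1 := as ! (i - 1) \<otimes>\<^bsub>G\<^esub> as ! i \<otimes>\<^bsub>G\<^esub> inv\<^bsub>G\<^esub> (as ! (i - 1)), i := as ! (i - 1)]"

definition hurwitz_word ::
    "('a, 'b) monoid_scheme \<Rightarrow> braid_letter list \<Rightarrow> 'a list \<Rightarrow> 'a list" where
  "hurwitz_word G w as = foldr (hurwitz_letter G) w as"

text \<open>
  The choice of the representative is irrelevant, see \<open>hurwitz_action_class\<close> below. The
  restriction to \<open>Red G A c\<close> makes the maps extensional, as \<^const>\<open>BijGroup\<close> requires.
\<close>

definition hurwitz_action ::
    "('a, 'b) monoid_scheme \<Rightarrow> 'a set \<Rightarrow> 'a \<Rightarrow> braid_letter list set \<Rightarrow> 'a list \<Rightarrow> 'a list" where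
  "hurwitz_action G A c \<beta> = (\<lambda>as \<in> Red G A c. hurwitz_word G (SOME w. w \<in> \<beta>) as)"


subsection \<open>The braid group is a group and the Hurwitz action is an action\<close>

lemma braid_eq_words:
  "braid_eq n u v \<Longrightarrow> u \<in> braid_words n \<and> v \<in> braid_words n"
  by (induction rule: braid_eq.induct) (auto simp: braid_words_def)

lemma equiv_braid_rel: "equiv (braid_words n) (braid_rel n)"
  by (intro equivI refl_onI symI transI)
    (auto simp: braid_rel_def dest: braid_eq_words intro: braid_eq.intros)

lemma braid_class_eq: "braid_eq n u v \<Longrightarrow> braid_rel n `` {u} = braid_rel n `` {v}"
  by (rule equiv_class_eq[OF equiv_braid_rel]) (simp add: braid_rel_def)

lemma braid_mult_class:
  assumes "u \<in> braid_words n" "v \<in> braid_words n"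
  shows "(braid_rel n `` {u}) \<otimes>\<^bsub>braid_group n\<^esub> (braid_rel n `` {v}) = braid_rel n `` {u @ v}"
proof -
  let ?X = "braid_rel n `` {u}" and ?Y = "braid_rel n `` {v}"
  have "braid_rel n `` {u' @ v'} = braid_rel n `` {u @ v}" if "u' \<in> ?X" "v' \<in> ?Y" for u' v'
    using that by (intro braid_class_eq) (auto simp: braid_rel_def intro: braid_eq.append braid_eq.sym)
  then have "(\<Union>u' \<in> ?X. \<Union>v' \<in> ?Y. braid_rel n `` {u' @ v'}) =
      (\<Union>u' \<in> ?X. \<Union>v' \<in> ?Y. braid_rel n `` {u @ v})"
    by (intro SUP_cong HOL.refl)
  moreover have "u \<in> ?X" "v \<in> ?Y"
    using assms by (auto simp: braid_rel_def intro: braid_eq.refl)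
  then have "(\<Union>u' \<in> ?X. \<Union>v' \<in> ?Y. braid_rel n `` {u @ v}) = braid_rel n `` {u @ v}"
    by blast
  ultimately show ?thesis
    by (simp add: braid_group_def)
qed

lemma braid_words_append:
  "u @ v \<in> braid_words n \<longleftrightarrow> u \<in> braid_words n \<and> v \<in> braid_words n"
  by (auto simp: braid_words_def)

lemma braid_inverse_word:
  "u \<in> braid_words n \<Longrightarrow> \<exists>v \<in> braid_words n. braid_eq n (v @ u) []"
proof (induction u)
  case Nil
  then show ?case by (intro bexI[of _ "[]"]) (auto simp: braid_words_def intro: braid_eq.refl)
next
  case (Cons l u)
  then obtain v where v: "v \<in> braid_words n" "braid_eq n (v @ u) []"
    by (auto simp: braid_words_def)
  from Cons.prems obtain i where i: "i \<in> {1..<n}" "l = Pos i \<or> l = Neg i"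
    by (auto simp: braid_words_def)
  then have "braid_eq n [if l = Pos i then Neg i else Pos i, l] []"
    using braid_eq.Pos_Neg[OF i(1)] braid_eq.Neg_Pos[OF i(1)] by auto
  then obtain l' where l': "[l'] \<in> braid_words n" "braid_eq n [l', l] []"
    using i(1) by (intro that[of "if l = Pos i then Neg i else Pos i"]) (auto simp: braid_words_def)
  have u: "u \<in> braid_words n" using Cons.prems by (auto simp: braid_words_def)
  have "braid_eq n ([l', l] @ u) ([] @ u)"
    by (rule braid_eq.append[OF l'(2) braid_eq.refl[OF u]])
  then have "braid_eq n (v @ ([l', l] @ u)) (v @ ([] @ u))"
    by (rule braid_eq.append[OF braid_eq.refl[OF v(1)]])
  then have "braid_eq n ((v @ [l']) @ (l # u)) []"
    using braid_eq.trans[OF _ v(2)] by simp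
  then show ?case
    using v l' by (intro bexI[of _ "v @ [l']"]) (auto simp: braid_words_append)
qed

theorem group_braid_group: "group (braid_group n)"
proof (rule groupI)
  have nil: "[] \<in> braid_words n" by (simp add: braid_words_def)
  have c: "X \<in> carrier (braid_group n) \<longleftrightarrow> (\<exists>u \<in> braid_words n. X = braid_rel n `` {u})" for X
    by (auto simp: braid_group_def quotient_def)
  have one: "\<one>\<^bsub>braid_group n\<^esub> = braid_rel n `` {[]}"
    by (simp add: braid_group_def)
  show "\<one>\<^bsub>braid_group n\<^esub> \<in> carrier (braid_group n)"
    using nil by (auto simp: c one)
  fix X assume "X \<in> carrier (braid_group n)"
  then obtain u where u: "u \<in> braid_words n" "X = braid_rel n `` {u}"
    by (auto simp: c)
  show "\<one>\<^bsub>braid_group n\<^esub> \<otimes>\<^bsub>braid_group n\<^esub> X = X"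
    using u nil by (simp add: one braid_mult_class)
  show "\<exists>Y \<in> carrier (braid_group n). Y \<otimes>\<^bsub>braid_group n\<^esub> X = \<one>\<^bsub>braid_group n\<^esub>"
  proof -
    obtain v where v: "v \<in> braid_words n" "braid_eq n (v @ u) []"
      using braid_inverse_word u by blast
    then show ?thesis
      using u by (intro bexI[of _ "braid_rel n `` {v}"])
        (auto simp: c one braid_mult_class dest: braid_class_eq)
  qed
  fix Y assume "Y \<in> carrier (braid_group n)"
  then obtain v where v: "v \<in> braid_words n" "Y = braid_rel n `` {v}"
    by (auto simp: c)
  show "X \<otimes>\<^bsub>braid_group n\<^esub> Y \<in> carrier (braid_group n)"
    using u v by (auto simp: c braid_mult_class braid_words_append)
  fix Z assume "Z \<in> carrier (braid_group n)"
  then obtain w where w: "w \<in> braid_words n" "Z = braid_rel n `` {w}"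
    by (auto simp: c)
  show "X \<otimes>\<^bsub>braid_group n\<^esub> Y \<otimes>\<^bsub>braid_group n\<^esub> Z = X \<otimes>\<^bsub>braid_group n\<^esub> (Y \<otimes>\<^bsub>braid_group n\<^esub> Z)"
    using u v w by (simp add: braid_mult_class braid_words_append)
qed

lemma hurwitz_letter_Pos:
  "hurwitz_letter G (Pos (Suc (length xs))) (xs @ a # b # ys) =
    xs @ b # (inv\<^bsub>G\<^esub> b \<otimes>\<^bsub>G\<^esub> a \<otimes>\<^bsub>G\<^esub> b) # ys"
  by (simp add: nth_append list_update_append)

lemma hurwitz_letter_Neg:
  "hurwitz_letter G (Neg (Suc (length xs))) (xs @ a # b # ys) =
    xs @ (a \<otimes>\<^bsub>G\<^esub> b \<otimes>\<^bsub>G\<^esub> inv\<^bsub>G\<^esub> a) # a # ys"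
  by (simp add: nth_append list_update_append)

lemma list_split2:
  assumes "i \<in> {1..<length as}"
  obtains xs a b ys where "as = xs @ a # b # ys" "i = Suc (length xs)"
proof
  have "drop (i - 1) as = as ! (i - 1) # as ! i # drop (Suc i) as"
    using assms Cons_nth_drop_Suc[of "i - 1" as] Cons_nth_drop_Suc[of i as] by auto
  then show "as = take (i - 1) as @ as ! (i - 1) # as ! i # drop (Suc i) as"
    by (metis append_take_drop_id)
  show "i = Suc (length (take (i - 1) as))"
    using assms by auto
qed

lemma list_split3:
  assumes "i \<in> {1..<length as}" "Suc i \<in> {1..<length as}"
  obtains xs a b d ys where "as = xs @ a # b # d # ys" "i = Suc (length xs)"
proof -
  from assms(1) obtain xs a b zs where *: "as = xs @ a # b # zs" "i = Suc (length xs)"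
    by (rule list_split2)
  with assms(2) obtain d ys where "zs = d # ys" by (cases zs) auto
  with * that show ?thesis by blast
qed

lemma list_split4:
  assumes "i \<in> {1..<length as}" "j \<in> {1..<length as}" "i + 2 \<le> j"
  obtains xs a b zs d e ys
    where "as = xs @ a # b # zs @ d # e # ys" "i = Suc (length xs)"
      "j = Suc (length (xs @ a # b # zs))"
proof -
  from assms(1) obtain xs a b us where *: "as = xs @ a # b # us" "i = Suc (length xs)"
    by (rule list_split2)
  have "j - i - 1 \<in> {1..<length us}" using assms * by auto
  then obtain zs d e ys where "us = zs @ d # e # ys" "j - i - 1 = Suc (length zs)"
    by (rule list_split2)
  with * assms(3) show ?thesis by (intro that[of xs a b zs d e ys]) auto
qed

context group
begin

lemma word_prod_closed: "set as \<subseteq> carrier G \<Longrightarrow> word_prod G as \<in> carrier G"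
  by (induction as) (auto simp: word_prod_def)

lemma word_prod_append:
  "set as \<subseteq> carrier G \<Longrightarrow> set bs \<subseteq> carrier G \<Longrightarrow>
    word_prod G (as @ bs) = word_prod G as \<otimes> word_prod G bs"
proof (induction as)
  case Nil
  then show ?case using word_prod_closed[of bs] by (simp add: word_prod_def)
next
  case (Cons a as)
  then show ?case
    using word_prod_closed[of as] word_prod_closed[of bs]
    by (simp add: word_prod_def m_assoc)
qed

lemma word_prod_Cons: "word_prod G (a # as) = a \<otimes> word_prod G as"
  by (simp add: word_prod_def)

lemma cancel_inv:
  "x \<in> carrier G \<Longrightarrow> y \<in> carrier G \<Longrightarrow> inv x \<otimes> (x \<otimes> y) = y"
  "x \<in> carrier G \<Longrightarrow> y \<in> carrier G \<Longrightarrow> x \<otimes> (inv x \<otimes> y) = y"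
  by (simp_all add: m_assoc[symmetric])

lemma hurwitz_letter_Red:
  assumes A: "A \<subseteq> carrier G"
    and conj: "\<forall>g \<in> carrier G. \<forall>a \<in> A. g \<otimes> a \<otimes> inv g \<in> A"
    and as: "as \<in> Red G A c" and i: "l \<in> {Pos i, Neg i}" "i \<in> {1..<wlen G A c}"
  shows "hurwitz_letter G l as \<in> Red G A c"
proof -
  from as have len: "length as = wlen G A c" by (simp add: Red_def)
  with i have "i \<in> {1..<length as}" by simp
  then obtain xs a b ys where *: "as = xs @ a # b # ys" "i = Suc (length xs)"
    by (rule list_split2)
  have ab: "a \<in> A" "b \<in> A" "set xs \<subseteq> A" "set ys \<subseteq> A"
    using as * by (auto simp: Red_def)
  have cl: "a \<in> carrier G" "b \<in> carrier G" "set xs \<subseteq> carrier G" "set ys \<subseteq> carrier G"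
    using ab A by auto
  note wc = word_prod_closed[OF cl(3)] word_prod_closed[OF cl(4)]
  have conj': "inv b \<otimes> a \<otimes> b \<in> A" using bspec[OF bspec[OF conj, of "inv b"], of a] cl ab by simp
  have conj'': "a \<otimes> b \<otimes> inv a \<in> A" using bspec[OF bspec[OF conj, of a], of b] cl ab by simp
  from i(1) consider "l = Pos i" | "l = Neg i" by blast
  then show ?thesis
  proof cases
    case 1
    have "word_prod G (xs @ b # (inv b \<otimes> a \<otimes> b) # ys) = word_prod G as"
      using cl wc * by (simp add: word_prod_append word_prod_Cons m_assoc cancel_inv)
    with 1 * as ab conj' show ?thesis
      by (simp only: 1 * hurwitz_letter_Pos) (auto simp: Red_def)
  next
    case 2
    have "word_prod G (xs @ (a \<otimes> b \<otimes> inv a) # a # ys) = word_prod G as"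
      using cl wc * by (simp add: word_prod_append word_prod_Cons m_assoc cancel_inv)
    with 2 * as ab conj'' show ?thesis
      by (simp only: 2 * hurwitz_letter_Neg) (auto simp: Red_def)
  qed
qed

lemma hurwitz_word_Red:
  assumes A: "A \<subseteq> carrier G"
    and conj: "\<forall>g \<in> carrier G. \<forall>a \<in> A. g \<otimes> a \<otimes> inv g \<in> A"
    and as: "as \<in> Red G A c" and w: "w \<in> braid_words (wlen G A c)"
  shows "hurwitz_word G w as \<in> Red G A c"
  using w
proof (induction w)
  case Nil
  then show ?case using as by (simp add: hurwitz_word_def)
next
  case (Cons l w)
  then have "hurwitz_word G w as \<in> Red G A c" by (auto simp: braid_words_def)
  moreover from Cons.prems obtain i where "l \<in> {Pos i, Neg i}" "i \<in> {1..<wlen G A c}"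
    by (auto simp: braid_words_def)
  ultimately have "hurwitz_letter G l (hurwitz_word G w as) \<in> Red G A c"
    by (intro hurwitz_letter_Red[OF A conj]) auto
  then show ?case by (simp add: hurwitz_word_def)
qed

lemma hurwitz_word_append:
  "hurwitz_word G (u @ v) as = hurwitz_word G u (hurwitz_word G v as)"
  by (simp add: hurwitz_word_def)

lemma hurwitz_word_cong:
  assumes A: "A \<subseteq> carrier G"
    and conj: "\<forall>g \<in> carrier G. \<forall>a \<in> A. g \<otimes> a \<otimes> inv g \<in> A"
    and uv: "braid_eq (wlen G A c) u v" and as: "as \<in> Red G A c"
  shows "hurwitz_word G u as = hurwitz_word G v as"
  using uv as
proof (induction arbitrary: as rule: braid_eq.induct)
  case (append u u' v v')
  have "hurwitz_word G v as \<in> Red G A c"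
    using append by (intro hurwitz_word_Red[OF A conj]) (auto dest: braid_eq_words)
  with append show ?case by (simp add: hurwitz_word_append)
next
  case (Pos_Neg i)
  then have *: "i \<in> {1..<length as}" "set as \<subseteq> carrier G" using A by (auto simp: Red_def)
  from *(1) obtain xs a b ys where "as = xs @ a # b # ys" "i = Suc (length xs)"
    by (rule list_split2)
  with * show ?case
    by (simp add: hurwitz_word_def hurwitz_letter_Pos hurwitz_letter_Neg m_assoc cancel_inv
        del: hurwitz_letter.simps)
next
  case (Neg_Pos i)
  then have *: "i \<in> {1..<length as}" "set as \<subseteq> carrier G" using A by (auto simp: Red_def)
  from *(1) obtain xs a b ys where "as = xs @ a # b # ys" "i = Suc (length xs)"
    by (rule list_split2)
  with * show ?case
    by (simp add: hurwitz_word_def hurwitz_letter_Pos hurwitz_letter_Neg m_assoc cancel_inv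
        del: hurwitz_letter.simps)
next
  case (braid i)
  then have *: "i \<in> {1..<length as}" "Suc i \<in> {1..<length as}" "set as \<subseteq> carrier G"
    using A by (auto simp: Red_def)
  from *(1,2) obtain xs a b d ys where d: "as = xs @ a # b # d # ys" "i = Suc (length xs)"
    by (rule list_split3)
  have P: "hurwitz_letter G (Pos (Suc (length xs))) (xs @ p # q # r # ys) =
      xs @ q # (inv q \<otimes> p \<otimes> q) # r # ys"
    "hurwitz_letter G (Pos (Suc (Suc (length xs)))) (xs @ p # q # r # ys) =
      xs @ p # r # (inv r \<otimes> q \<otimes> r) # ys" for p q r
    using hurwitz_letter_Pos[of G xs p q "r # ys"] hurwitz_letter_Pos[of G "xs @ [p]" q r ys]
    by simp_all
  from d *(3) show ?case
    by (simp add: hurwitz_word_def P m_assoc cancel_inv inv_mult_group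
        del: hurwitz_letter.simps)
next
  case (comm i j)
  then have *: "i \<in> {1..<length as}" "j \<in> {1..<length as}" "i + 2 \<le> j"
    by (auto simp: Red_def)
  then obtain xs a b zs d e ys where d: "as = xs @ a # b # zs @ d # e # ys"
      "i = Suc (length xs)" "j = Suc (length (xs @ a # b # zs))"
    by (rule list_split4)
  have P: "hurwitz_letter G (Pos i) (xs @ p # q # zs @ r # s # ys) =
      xs @ q # (inv q \<otimes> p \<otimes> q) # zs @ r # s # ys"
    "hurwitz_letter G (Pos j) (xs @ p # q # zs @ r # s # ys) =
      xs @ p # q # zs @ s # (inv s \<otimes> r \<otimes> s) # ys" for p q r s
    using hurwitz_letter_Pos[of G xs p q "zs @ r # s # ys"]
      hurwitz_letter_Pos[of G "xs @ p # q # zs" r s ys] d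
    by simp_all
  show ?case
    by (simp add: hurwitz_word_def d(1) P del: hurwitz_letter.simps)
qed auto

lemma hurwitz_action_class:
  assumes A: "A \<subseteq> carrier G"
    and conj: "\<forall>g \<in> carrier G. \<forall>a \<in> A. g \<otimes> a \<otimes> inv g \<in> A"
    and as: "as \<in> Red G A c" and u: "u \<in> braid_words (wlen G A c)"
  shows "hurwitz_action G A c (braid_rel (wlen G A c) `` {u}) as = hurwitz_word G u as"
proof -
  let ?X = "braid_rel (wlen G A c) `` {u}"
  have "u \<in> ?X" using u by (auto simp: braid_rel_def intro: braid_eq.refl)
  then have "(SOME w. w \<in> ?X) \<in> ?X" by (rule someI)
  then have "braid_eq (wlen G A c) u (SOME w. w \<in> ?X)" by (simp add: braid_rel_def)
  from hurwitz_word_cong[OF A conj this as] show ?thesis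
    using as by (simp add: hurwitz_action_def)
qed

theorem hurwitz_group_action:
  assumes A: "A \<subseteq> carrier G"
    and conj: "\<forall>g \<in> carrier G. \<forall>a \<in> A. g \<otimes> a \<otimes> inv g \<in> A"
  shows "group_action (braid_group (wlen G A c)) (Red G A c) (hurwitz_action G A c)"
proof -
  let ?n = "wlen G A c" and ?E = "Red G A c"
  let ?B = "braid_group ?n" and ?h = "hurwitz_action G A c"
  have c: "X \<in> carrier ?B \<longleftrightarrow> (\<exists>u \<in> braid_words ?n. X = braid_rel ?n `` {u})" for X
    by (auto simp: braid_group_def quotient_def)
  note cls = hurwitz_action_class[OF A conj]
  note red = hurwitz_word_Red[OF A conj]
  note wcong = hurwitz_word_cong[OF A conj]
  interpret B: group ?B by (rule group_braid_group)
  have mult: "?h (X \<otimes>\<^bsub>?B\<^esub> Y) as = ?h X (?h Y as)" "?h Y as \<in> ?E"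
    if XY: "X \<in> carrier ?B" "Y \<in> carrier ?B" and as: "as \<in> ?E" for X Y as
  proof -
    obtain u v where "u \<in> braid_words ?n" "X = braid_rel ?n `` {u}"
        "v \<in> braid_words ?n" "Y = braid_rel ?n `` {v}"
      using XY by (auto simp: c)
    with as show "?h (X \<otimes>\<^bsub>?B\<^esub> Y) as = ?h X (?h Y as)" "?h Y as \<in> ?E"
      by (simp_all add: braid_mult_class cls red braid_words_append hurwitz_word_append)
  qed
  have one: "?h \<one>\<^bsub>?B\<^esub> as = as" if "as \<in> ?E" for as
    using cls[OF that, of "[]"] by (simp add: braid_group_def braid_words_def hurwitz_word_def)
  have bij: "?h X \<in> Bij ?E" if X: "X \<in> carrier ?B" for X
  proof -
    have "bij_betw (?h X) ?E ?E"
    proof (rule bij_betw_byWitness[where f' = "?h (inv\<^bsub>?B\<^esub> X)"])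
      show "\<forall>as\<in>?E. ?h (inv\<^bsub>?B\<^esub> X) (?h X as) = as"
        using X mult(1)[of "inv\<^bsub>?B\<^esub> X" X] one by simp
      show "\<forall>as\<in>?E. ?h X (?h (inv\<^bsub>?B\<^esub> X) as) = as"
        using X mult(1)[of X "inv\<^bsub>?B\<^esub> X"] one by simp
    qed (use X mult(2) B.inv_closed in blast)+
    then show ?thesis by (simp add: Bij_def hurwitz_action_def)
  qed
  have "?h (X \<otimes>\<^bsub>?B\<^esub> Y) = compose ?E (?h X) (?h Y)"
    if "X \<in> carrier ?B" "Y \<in> carrier ?B" for X Y
    using mult(1)[OF that] by (intro extensionalityI[of _ ?E]) (auto simp: hurwitz_action_def compose_def)
  then have "?h \<in> hom ?B (BijGroup ?E)"
    using bij by (auto simp: hom_def BijGroup_def)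
  then show ?thesis
    by (intro group_action.intro group_hom.intro group_hom_axioms.intro)
      (auto simp: group_braid_group group_BijGroup)
qed

end

end

theory Submission
  imports Defs
begin

text \<open>
  The maximal chains of \<open>[e, c]\<close> are the sets of prefix products of the reduced factorizations of
  \<open>c\<close>. Chains that differ in one element come from factorizations that differ in two adjacent
  letters with the same product \<open>g\<close> of length 2, so chain-connectedness reduces the claim to a
  single braid generator acting on the factorizations of \<open>g\<close>. Every orbit there contains a weak
  ascent, and compatibility of the order says that there is only one.
\<close>

section \<open>Least elements of finite sets under a linear order\<close>

lemma linear_order_least:
  assumes lin: "linear_order_on X r" and "finite S" "S \<noteq> {}" "S \<subseteq> X"
  shows "\<exists>m \<in> S. \<forall>x \<in> S. (m, x) \<in> r"
  using assms(2-)
proof (induction S rule: finite_ne_induct)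
  case (singleton x)
  then show ?case using lin by (auto simp: order_on_defs refl_on_def)
next
  case (insert x S)
  then obtain m where m: "m \<in> S" "\<forall>y \<in> S. (m, y) \<in> r" by auto
  have refl: "(x, x) \<in> r"
    using lin insert.prems by (auto simp: order_on_defs refl_on_def)
  \<comment> \<open>\<open>total_on\<close> speaks of distinct elements only, so
    \<open>x = m\<close> is settled by reflexivity.\<close>
  moreover have "(x, m) \<in> r \<or> (m, x) \<in> r"
    using lin insert.prems m(1) refl
    by (cases "x = m") (auto simp: order_on_defs total_on_def)
  moreover have "trans r" using lin by (simp add: order_on_defs)
  ultimately show ?case using m by (metis insert_iff transD)
qed

section \<open>Word length over a conjugation-closed generating set\<close>

locale conj_generated_group = group G for G (structure) +
  fixes A :: "'a set"
  assumes A_carrier: "A \<subseteq> carrier G"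
    and A_generates: "monoid_generated G A = carrier G"
    and A_conj: "\<forall>g \<in> carrier G. \<forall>a \<in> A. g \<otimes> a \<otimes> inv g \<in> A"
begin

lemma word_carrier: "set as \<subseteq> A \<Longrightarrow> word_prod G as \<in> carrier G"
  using A_carrier by (intro word_prod_closed) auto

lemma word_append:
  "set as \<subseteq> A \<Longrightarrow> set bs \<subseteq> A \<Longrightarrow> word_prod G (as @ bs) = word_prod G as \<otimes> word_prod G bs"
  using A_carrier by (intro word_prod_append) auto

text \<open>Products of words over \<open>A\<close> form a submonoid containing \<open>A\<close>,
  hence all of \<open>G\<close>. The minimum in \<open>wlen\<close> is therefore attained on
  \<open>carrier G\<close>.\<close>

lemma word_exists:
  assumes "x \<in> carrier G"
  obtains as where "set as \<subseteq> A" "word_prod G as = x"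
proof -
  let ?H = "word_prod G ` lists A"
  have "submonoid ?H G"
  proof
    show "?H \<subseteq> carrier G" using word_carrier by auto
    show "\<one> \<in> ?H" by (auto simp: word_prod_def intro!: image_eqI[of _ _ "[]"])
    fix x y assume "x \<in> ?H" "y \<in> ?H"
    then obtain as bs where "as \<in> lists A" "x = word_prod G as" "bs \<in> lists A" "y = word_prod G bs"
      by blast
    then show "x \<otimes> y \<in> ?H"
      using word_append[of as bs] by (intro image_eqI[of _ _ "as @ bs"]) (auto simp: in_lists_conv_set subset_iff)
  qed
  moreover have "A \<subseteq> ?H"
  proof
    fix a assume "a \<in> A"
    then show "a \<in> ?H"
      using A_carrier by (intro image_eqI[of _ _ "[a]"]) (auto simp: word_prod_def)
  qed
  ultimately have "monoid_generated G A \<subseteq> ?H"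
    unfolding monoid_generated_def by blast
  with assms A_generates have "x \<in> ?H" by blast
  with that show ?thesis by blast
qed

lemma wlen_word_le: "set as \<subseteq> A \<Longrightarrow> wlen G A (word_prod G as) \<le> length as"
  unfolding wlen_def by (rule Least_le) auto

lemma Red_exists:
  assumes "x \<in> carrier G"
  obtains as where "as \<in> Red G A x"
proof -
  obtain bs where "set bs \<subseteq> A" "word_prod G bs = x"
    using assms by (rule word_exists)
  then have "\<exists>k as. set as \<subseteq> A \<and> length as = k \<and> word_prod G as = x" by blast
  from LeastI_ex[OF this] that show ?thesis by (auto simp: Red_def wlen_def)
qed

lemma RedD:
  assumes "as \<in> Red G A x"
  shows "set as \<subseteq> A" "word_prod G as = x" "length as = wlen G A x"
  using assms by (auto simp: Red_def)

lemma wlen_mult: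
  assumes "x \<in> carrier G" "y \<in> carrier G"
  shows "wlen G A (x \<otimes> y) \<le> wlen G A x + wlen G A y"
proof -
  obtain as bs where as: "as \<in> Red G A x" and bs: "bs \<in> Red G A y"
    using assms Red_exists by metis
  then show ?thesis
    using wlen_word_le[of "as @ bs"] word_append[of as bs] RedD[OF as] RedD[OF bs] by simp
qed

lemma wlen_one: "wlen G A \<one> = 0"
  using wlen_word_le[of "[]"] by (simp add: word_prod_def)

lemma wlen_eq_0:
  assumes "x \<in> carrier G" "wlen G A x = 0"
  shows "x = \<one>"
proof -
  obtain as where "as \<in> Red G A x" using assms(1) by (rule Red_exists)
  with assms(2) show ?thesis by (auto simp: Red_def word_prod_def)
qed

lemma word_prod_conj:
  assumes "g \<in> carrier G" "set as \<subseteq> A"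
  shows "word_prod G (map (\<lambda>a. g \<otimes> a \<otimes> inv g) as) = g \<otimes> word_prod G as \<otimes> inv g"
  using assms(2)
proof (induction as)
  case Nil
  then show ?case using assms(1) by (simp add: word_prod_def)
next
  case (Cons a as)
  then show ?case
    using assms(1) A_carrier word_carrier[of as]
    by (simp add: word_prod_Cons subset_iff m_assoc cancel_inv)
qed

text \<open>Conjugating a reduced word letter by letter keeps its letters in \<open>A\<close> and
  preserves their number.\<close>

lemma wlen_conj:
  assumes "g \<in> carrier G" "x \<in> carrier G"
  shows "wlen G A (g \<otimes> x \<otimes> inv g) \<le> wlen G A x"
proof -
  obtain as where as: "as \<in> Red G A x" using assms(2) by (rule Red_exists)
  have "set (map (\<lambda>a. g \<otimes> a \<otimes> inv g) as) \<subseteq> A"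
    using RedD(1)[OF as] A_conj assms(1) by auto
  from wlen_word_le[OF this] show ?thesis
    using RedD[OF as] assms(1) by (simp add: word_prod_conj)
qed

text \<open>Let c = x u y be the product of the three parts. Moving x past u by conjugation gives c
  = u z, where z is y preceded by a conjugate of x and so has length at most that of x plus that of
  y. Hence the length of c is at most the sum of the lengths of x, u and y, which is at most the
  number of letters, that is, the length of c. Equality holds throughout.\<close>

lemma Red_infix:
  assumes "xs @ us @ ys \<in> Red G A c"
  shows "wlen G A (word_prod G us) = length us" "prefix_le G A (word_prod G us) c"
proof -
  define x u y where "x = word_prod G xs" and "u = word_prod G us" and "y = word_prod G ys"
  have A: "set xs \<subseteq> A" "set us \<subseteq> A" "set ys \<subseteq> A"
    using RedD(1)[OF assms] by auto
  have cl: "x \<in> carrier G" "u \<in> carrier G" "y \<in> carrier G"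
    using A by (auto simp: x_def u_def y_def word_carrier)
  have c: "c = x \<otimes> (u \<otimes> y)"
    using RedD(2)[OF assms] A by (simp add: word_append x_def u_def y_def)
  have le: "wlen G A x \<le> length xs" "wlen G A u \<le> length us" "wlen G A y \<le> length ys"
    using A by (auto simp: x_def u_def y_def wlen_word_le)
  have len: "wlen G A c = length xs + length us + length ys"
    using RedD(3)[OF assms] by simp
  \<comment> \<open>The double inverse gives the first factor the shape that
    \<open>wlen_conj\<close> expects.\<close>
  define z where "z = (inv u \<otimes> x \<otimes> inv (inv u)) \<otimes> y"
  have z: "z \<in> carrier G" "inv u \<otimes> c = z"
    using cl by (auto simp: z_def c m_assoc)
  have "wlen G A z \<le> wlen G A x + wlen G A y"
    using cl wlen_mult[of "inv u \<otimes> x \<otimes> inv (inv u)" y] wlen_conj[of "inv u" x] by (simp add: z_def)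
  moreover have "wlen G A c \<le> wlen G A u + wlen G A z"
    using wlen_mult[of u z] cl z(1) unfolding z(2)[symmetric]
    by (simp add: c cancel_inv)
  ultimately show "wlen G A (word_prod G us) = length us" "prefix_le G A (word_prod G us) c"
    using le len by (auto simp: prefix_le_def z(2) simp flip: u_def)
qed

section \<open>Prefix products and maximal chains\<close>

definition prefix_prods :: "'a list \<Rightarrow> 'a set" where
  "prefix_prods as = (\<lambda>i. word_prod G (take i as)) ` {..length as}"

text \<open>This lets the index of a prefix product be read off from the group element.\<close>

lemma wlen_take:
  assumes "as \<in> Red G A c" "i \<le> length as"
  shows "wlen G A (word_prod G (take i as)) = i"
  using Red_infix(1)[of "[]" "take i as" "drop i as" c] assms by simp

text \<open>The quotient of the two products is the product of the letters in between, whose length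
  is their number by \<open>Red_infix\<close>.\<close>

lemma prefix_le_take:
  assumes as: "as \<in> Red G A c" and ij: "i \<le> j" "j \<le> length as"
  shows "prefix_le G A (word_prod G (take i as)) (word_prod G (take j as))"
proof -
  let ?us = "drop i (take j as)"
  have split: "take j as = take i as @ ?us"
    using ij by (metis append_take_drop_id min.absorb1 take_take)
  have A: "set (take i as) \<subseteq> A" "set ?us \<subseteq> A"
    using RedD(1)[OF as] by (meson set_take_subset set_drop_subset order_trans)+
  have "wlen G A (word_prod G ?us) = length ?us"
    using Red_infix(1)[of "take i as" ?us "drop j as" c] as
    by (metis append.assoc append_take_drop_id split)
  moreover have "word_prod G (take j as) = word_prod G (take i as) \<otimes> word_prod G ?us"
    using word_append[OF A] split by simp
  ultimately show ?thesis
    using wlen_take[OF as, of i] wlen_take[OF as, of j] ij A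
    by (simp add: prefix_le_def word_carrier cancel_inv)
qed

lemma prefix_le_antisym_wlen:
  assumes "x \<in> carrier G" "y \<in> carrier G" "prefix_le G A x y" "wlen G A y \<le> wlen G A x"
  shows "x = y"
proof -
  have "inv x \<otimes> y = \<one>"
    using assms by (intro wlen_eq_0) (auto simp: prefix_le_def)
  then show ?thesis using assms(1,2) by (metis cancel_inv(2) r_one)
qed

lemma prefix_le_refl: "x \<in> carrier G \<Longrightarrow> prefix_le G A x x"
  by (simp add: prefix_le_def wlen_one)

lemma prefix_le_one: "x \<in> carrier G \<Longrightarrow> prefix_le G A \<one> x"
  by (simp add: prefix_le_def wlen_one)

abbreviation chain_below :: "'a \<Rightarrow> 'a set \<Rightarrow> bool" where
  "chain_below c \<equiv> pred_on.chain (carrier (factorization_poset G A c)) (le (factorization_poset G A c))"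

abbreviation maxchain_below :: "'a \<Rightarrow> 'a set \<Rightarrow> bool" where
  "maxchain_below c \<equiv>
    pred_on.maxchain (carrier (factorization_poset G A c)) (le (factorization_poset G A c))"

text \<open>The reflexive closure in \<open>pred_on.chain\<close> is absorbed by reflexivity of
  \<open>prefix_le\<close>, and the lower bound by \<open>prefix_le_one\<close>.\<close>

lemma chain_below_iff:
  "chain_below c C \<longleftrightarrow> C \<subseteq> carrier G \<and> (\<forall>x \<in> C. prefix_le G A x c) \<and>
    (\<forall>x \<in> C. \<forall>y \<in> C. prefix_le G A x y \<or> prefix_le G A y x)"
proof -
  let ?le = "le (factorization_poset G A c)"
  have le: "?le\<^sup>=\<^sup>= x y \<longleftrightarrow> prefix_le G A x y" if "x \<in> carrier G" for x y
    using that prefix_le_refl by (auto simp: factorization_poset_def)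
  have "C \<subseteq> carrier (factorization_poset G A c) \<longleftrightarrow>
      C \<subseteq> carrier G \<and> (\<forall>x \<in> C. prefix_le G A x c)"
    using prefix_le_one by (auto simp: factorization_poset_def)
  moreover have "(\<forall>x \<in> C. \<forall>y \<in> C. ?le\<^sup>=\<^sup>= x y \<or> ?le\<^sup>=\<^sup>= y x) \<longleftrightarrow>
      (\<forall>x \<in> C. \<forall>y \<in> C. prefix_le G A x y \<or> prefix_le G A y x)" if "C \<subseteq> carrier G"
    using that by (intro ball_cong HOL.refl) (metis le subsetD)
  ultimately show ?thesis unfolding pred_on.chain_def by blast
qed

lemma chain_wlen_inj:
  assumes "chain_below c C" "x \<in> C" "y \<in> C" "wlen G A x = wlen G A y"
  shows "x = y"
  using assms prefix_le_antisym_wlen unfolding chain_below_iff by (metis order_refl subset_iff)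

lemma chain_prefix_prods:
  assumes as: "as \<in> Red G A c"
  shows "chain_below c (prefix_prods as)"
  unfolding chain_below_iff
proof (intro conjI ballI)
  have "set (take i as) \<subseteq> A" for i
    using RedD(1)[OF as] by (meson set_take_subset order_trans)
  then show "prefix_prods as \<subseteq> carrier G" by (auto simp: prefix_prods_def word_carrier)
next
  fix x assume "x \<in> prefix_prods as"
  then obtain i where i: "i \<le> length as" "x = word_prod G (take i as)"
    by (auto simp: prefix_prods_def)
  then show "prefix_le G A x c"
    using prefix_le_take[OF as i(1) order_refl] RedD(2)[OF as] by simp
  fix y assume "y \<in> prefix_prods as"
  then obtain j where j: "j \<le> length as" "y = word_prod G (take j as)"
    by (auto simp: prefix_prods_def)
  then show "prefix_le G A x y \<or> prefix_le G A y x"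
    using prefix_le_take[OF as] i by (cases "i \<le> j") auto
qed

text \<open>An element of a larger chain has length at most that of c, and the prefix product of
  this length is already in the chain; \<open>chain_wlen_inj\<close> identifies the two.\<close>

lemma maxchain_prefix_prods:
  assumes as: "as \<in> Red G A c"
  shows "maxchain_below c (prefix_prods as)"
proof -
  have "S \<subseteq> prefix_prods as" if S: "chain_below c S" "prefix_prods as \<subset> S" for S
  proof
    fix x assume x: "x \<in> S"
    then have "wlen G A x \<le> length as"
      using S(1) RedD(3)[OF as] by (auto simp: chain_below_iff prefix_le_def)
    moreover from this have *: "word_prod G (take (wlen G A x) as) \<in> prefix_prods as"
      by (auto simp: prefix_prods_def)
    ultimately have "x = word_prod G (take (wlen G A x) as)"
      using chain_wlen_inj[OF S(1) x] S(2) wlen_take[OF as] by auto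
    with * show "x \<in> prefix_prods as" by simp
  qed
  with chain_prefix_prods[OF as] show ?thesis
    by (auto simp: pred_on.maxchain_def)
qed

text \<open>Induction by increasing length with \<open>c\<close> arbitrary: the remaining chain lies
  below its longest element \<open>x\<close>, and a reduced word of \<open>x\<close> covering it is
  extended by a reduced word of \<open>inv x \<otimes> c\<close>.\<close>

lemma chain_subset_prefix_prods:
  assumes "finite C" "chain_below c C" "c \<in> carrier G"
  obtains as where "as \<in> Red G A c" "C \<subseteq> prefix_prods as"
proof -
  from assms have "\<exists>as \<in> Red G A c. C \<subseteq> prefix_prods as"
  proof (induction C arbitrary: c rule: finite_ranking_induct[where f = "wlen G A"])
    case empty
    then show ?case using Red_exists by blast
  next
    case (insert x C)
    have x: "x \<in> carrier G" "prefix_le G A x c" and ch: "chain_below c C"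
      using insert.prems by (auto simp: chain_below_iff)
    \<comment> \<open>The elements are comparable and \<open>y\<close> is not longer than
      \<open>x\<close>, so the opposite comparison would force equality.\<close>
    have "prefix_le G A y x" if "y \<in> C" for y
      using insert.prems(1) insert.hyps(2)[OF that] that prefix_le_antisym_wlen[of x y]
      unfolding chain_below_iff by blast
    with ch have "chain_below x C" by (auto simp: chain_below_iff)
    from insert.IH[OF this x(1)] obtain as where as: "as \<in> Red G A x" "C \<subseteq> prefix_prods as" by blast
    obtain bs where bs: "bs \<in> Red G A (inv x \<otimes> c)"
      using x(1) insert.prems(2) by (meson Red_exists inv_closed m_closed)
    have "as @ bs \<in> Red G A c"
      using RedD[OF as(1)] RedD[OF bs] x insert.prems(2) word_append[of as bs]
      by (auto simp: Red_def cancel_inv prefix_le_def)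
    moreover have "prefix_prods as \<subseteq> prefix_prods (as @ bs)"
    proof
      fix y assume "y \<in> prefix_prods as"
      then obtain i where "i \<le> length as" "y = word_prod G (take i as)"
        by (auto simp: prefix_prods_def)
      then show "y \<in> prefix_prods (as @ bs)"
        unfolding prefix_prods_def by (intro image_eqI[of _ _ i]) auto
    qed
    moreover have "x \<in> prefix_prods as"
      using RedD[OF as(1)] by (auto simp: prefix_prods_def intro!: image_eqI[of _ _ "length as"])
    ultimately show ?case using as(2) by blast
  qed
  with that show ?thesis by blast
qed

text \<open>The length embeds a chain into an initial segment of the naturals, so it is finite and
  lies in a chain of prefix products; maximality gives equality.\<close>

lemma maxchain_is_prefix_prods:
  assumes "maxchain_below c C" "c \<in> carrier G"
  obtains as where "as \<in> Red G A c" "C = prefix_prods as"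
proof -
  from assms(1) have ch: "chain_below c C" and max: "\<And>S. chain_below c S \<Longrightarrow> C \<subseteq> S \<Longrightarrow> C = S"
    by (auto simp: pred_on.maxchain_def)
  have "inj_on (wlen G A) C"
    using chain_wlen_inj[OF ch] by (auto simp: inj_on_def)
  moreover have "wlen G A ` C \<subseteq> {..wlen G A c}"
    using ch by (auto simp: chain_below_iff prefix_le_def)
  ultimately have "finite C" by (meson finite_atMost inj_on_finite)
  then obtain as where "as \<in> Red G A c" "C \<subseteq> prefix_prods as"
    using chain_subset_prefix_prods[OF _ ch assms(2)] by blast
  with max[OF chain_prefix_prods] that show ?thesis by blast
qed

section \<open>Chains that differ in one element\<close>

lemma take_prod_in_prefix_prods:
  assumes as: "as \<in> Red G A c" and bs: "bs \<in> Red G A c" and i: "i \<le> length as"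
    and mem: "word_prod G (take i as) \<in> prefix_prods bs"
  shows "word_prod G (take i as) = word_prod G (take i bs)"
proof -
  from mem obtain j where j: "j \<le> length bs" "word_prod G (take i as) = word_prod G (take j bs)"
    by (auto simp: prefix_prods_def)
  with wlen_take[OF as i] wlen_take[OF bs j(1)] show ?thesis by simp
qed

lemma nth_eq_prods:
  assumes "set as \<subseteq> A" "i < length as"
  shows "as ! i = inv (word_prod G (take i as)) \<otimes> word_prod G (take (Suc i) as)"
proof -
  have A: "set (take i as) \<subseteq> A" "set [as ! i] \<subseteq> A"
    using assms by (meson set_take_subset order_trans) (use assms in auto)
  then have "as ! i \<in> carrier G" using A_carrier by auto
  with word_append[OF A] assms(2) word_carrier[OF A(1)] show ?thesis
    by (simp add: take_Suc_conv_app_nth word_prod_def cancel_inv)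
qed

text \<open>Only the prefix product at one index \<open>i\<close> differs. By
  \<open>nth_eq_prods\<close> a letter depends on two consecutive prefix products, so only the
  letters at positions \<open>i - 1\<close> and \<open>i\<close> can change.\<close>

lemma adjacent_prefix_prods:
  assumes as: "as \<in> Red G A c" and bs: "bs \<in> Red G A c"
    and card: "card (prefix_prods as - prefix_prods bs) = 1"
  obtains xs a b a' b' ys where "as = xs @ a # b # ys" "bs = xs @ a' # b' # ys"
proof -
  let ?p = "\<lambda>i. word_prod G (take i as)" and ?q = "\<lambda>i. word_prod G (take i bs)"
  note len = RedD(3)[OF as] RedD(3)[OF bs]
  obtain x where x: "prefix_prods as - prefix_prods bs = {x}"
    using card by (meson card_1_singletonE)
  then have "x \<in> prefix_prods as" by blast
  then obtain i where i: "i \<le> length as" "x = ?p i" by (auto simp: prefix_prods_def)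
  have eq: "?p j = ?q j" if "j \<le> length as" "j \<noteq> i" for j
  proof (rule take_prod_in_prefix_prods[OF as bs that(1)])
    have "?p j \<noteq> x" using i that wlen_take[OF as] by metis
    moreover have "?p j \<in> prefix_prods as" using that by (auto simp: prefix_prods_def)
    ultimately show "?p j \<in> prefix_prods bs" using x by blast
  qed
  have ne: "?p i \<noteq> ?q i"
    using x i len by (auto simp: prefix_prods_def)
  \<comment> \<open>The prefix products at both ends are the identity and \<open>c\<close> for
    either word, so \<open>i\<close> is interior.\<close>
  have "i \<noteq> 0" using ne by (intro notI) simp
  moreover have "i \<noteq> length as" using ne RedD(2)[OF as] RedD(2)[OF bs] len by auto
  ultimately have i': "i \<in> {1..<length as}" using i(1) by auto
  have nth: "as ! j = bs ! j" if "j < length as" "j \<noteq> i" "Suc j \<noteq> i" for j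
    using that eq[of j] eq[of "Suc j"] nth_eq_prods[OF RedD(1)[OF as]] nth_eq_prods[OF RedD(1)[OF bs]]
      len by simp
  from i' obtain xs a b ys where 1: "as = xs @ a # b # ys" "i = Suc (length xs)"
    by (rule list_split2)
  have "i \<in> {1..<length bs}" using i' len by simp
  then obtain xs' a' b' ys' where 2: "bs = xs' @ a' # b' # ys'" "i = Suc (length xs')"
    by (rule list_split2)
  have "xs = take (i - 1) as" "xs' = take (i - 1) bs" "ys = drop (Suc i) as" "ys' = drop (Suc i) bs"
    using 1 2 by auto
  moreover have "take (i - 1) as = take (i - 1) bs"
    using nth len i' by (intro nth_equalityI) auto
  moreover have "drop (Suc i) as = drop (Suc i) bs"
    using nth len i' by (intro nth_equalityI) auto
  ultimately have "xs' = xs" "ys' = ys" by argo+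
  with 1(1) 2(1) that show ?thesis by blast
qed

section \<open>Hurwitz orbits and weak ascents\<close>

abbreviation hurwitz_orbit :: "'a \<Rightarrow> 'a list \<Rightarrow> 'a list set" where
  "hurwitz_orbit c \<equiv> orbit (braid_group (wlen G A c)) (hurwitz_action G A c)"

lemmas Red_group_action = hurwitz_group_action[OF A_carrier A_conj]

lemma hurwitz_orbit_subset: "as \<in> Red G A c \<Longrightarrow> hurwitz_orbit c as \<subseteq> Red G A c"
  using group_action.element_image[OF Red_group_action] by (auto simp: orbit_def)

lemma hurwitz_step:
  assumes "xs @ a # b # ys \<in> Red G A c"
  shows "xs @ b # (inv b \<otimes> a \<otimes> b) # ys \<in> hurwitz_orbit c (xs @ a # b # ys)"
proof -
  let ?i = "Suc (length xs)" and ?n = "wlen G A c"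
  have "?i \<in> {1..<?n}" using RedD(3)[OF assms] by simp
  then have w: "[Pos ?i] \<in> braid_words ?n" by (auto simp: braid_words_def)
  have "hurwitz_action G A c (braid_rel ?n `` {[Pos ?i]}) (xs @ a # b # ys) =
      xs @ b # (inv b \<otimes> a \<otimes> b) # ys"
    using hurwitz_action_class[OF A_carrier A_conj assms w]
    by (simp add: hurwitz_word_def hurwitz_letter_Pos del: hurwitz_letter.simps)
  moreover have "braid_rel ?n `` {[Pos ?i]} \<in> carrier (braid_group ?n)"
    using w by (auto simp: braid_group_def quotient_def)
  ultimately show ?thesis unfolding orbit_def by force
qed

text \<open>
  The first letters of the pairs that occur at a fixed position in an orbit form a finite set.
  Its least element starts a weak ascent, since a Hurwitz move makes the second letter the first.
\<close>

lemma hurwitz_orbit_ascent: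
  assumes fin: "finite (Red G A c)" and lin: "linear_order_on (atoms_below G A c) r"
    and red: "xs @ a # b # ys \<in> Red G A c"
  obtains p q where "xs @ p # q # ys \<in> hurwitz_orbit c (xs @ a # b # ys)" "(p, q) \<in> r"
proof -
  interpret H: group_action "braid_group (wlen G A c)" "Red G A c" "hurwitz_action G A c"
    by (rule Red_group_action)
  let ?O = "hurwitz_orbit c (xs @ a # b # ys)"
  let ?S = "{p. \<exists>q. xs @ p # q # ys \<in> ?O}"
  note sub = hurwitz_orbit_subset[OF red]
  have "?S \<subseteq> (\<lambda>as. as ! length xs) ` ?O" by force
  then have "finite ?S" using fin sub by (meson finite_imageI finite_subset)
  moreover have "?S \<noteq> {}" using H.orbit_refl[OF red] by blast
  moreover have "?S \<subseteq> atoms_below G A c"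
  proof
    fix p assume "p \<in> ?S"
    \<comment> \<open>Isolating \<open>[p]\<close> as an infix makes \<open>Red_infix\<close> yield
      that \<open>p\<close> lies below \<open>c\<close>.\<close>
    then obtain q where q: "xs @ [p] @ q # ys \<in> Red G A c" using sub by auto
    then have "p \<in> A" using RedD(1) by fastforce
    then show "p \<in> atoms_below G A c"
      using Red_infix(2)[OF q] A_carrier by (auto simp: atoms_below_def word_prod_def)
  qed
  ultimately obtain p where p: "p \<in> ?S" "\<forall>x \<in> ?S. (p, x) \<in> r"
    using linear_order_least[OF lin] by meson
  then obtain q where q: "xs @ p # q # ys \<in> ?O" by blast
  have "xs @ q # (inv q \<otimes> p \<otimes> q) # ys \<in> ?O"
    using H.orbit_trans[OF red _ _ q] hurwitz_step[of xs p q ys c]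
      hurwitz_orbit_subset[of "xs @ p # q # ys" c] q sub by blast
  with p(2) have "(p, q) \<in> r" by blast
  with q that show ?thesis by blast
qed

text \<open>Both orbits contain a weak ascent between \<open>xs\<close> and \<open>ys\<close>.
  Cancelling this context shows that the two ascents factor the same \<open>g\<close>, which has
  length 2 and lies below \<open>c\<close> by \<open>Red_infix\<close>. Compatibility makes them
  equal, so the orbits meet.\<close>

lemma hurwitz_orbit_rank_two:
  assumes fin: "finite (Red G A c)" and r: "compatible_order G A c r"
    and red: "xs @ a # b # ys \<in> Red G A c" "xs @ a' # b' # ys \<in> Red G A c"
  shows "xs @ a' # b' # ys \<in> hurwitz_orbit c (xs @ a # b # ys)"
proof -
  interpret H: group_action "braid_group (wlen G A c)" "Red G A c" "hurwitz_action G A c"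
    by (rule Red_group_action)
  have lin: "linear_order_on (atoms_below G A c) r"
    using r by (simp add: compatible_order_def)
  obtain p q where pq: "xs @ p # q # ys \<in> hurwitz_orbit c (xs @ a # b # ys)" "(p, q) \<in> r"
    by (rule hurwitz_orbit_ascent[OF fin lin red(1)])
  obtain p' q' where pq': "xs @ p' # q' # ys \<in> hurwitz_orbit c (xs @ a' # b' # ys)" "(p', q') \<in> r"
    by (rule hurwitz_orbit_ascent[OF fin lin red(2)])
  define g where "g = word_prod G [p, q]"
  have R: "xs @ [p, q] @ ys \<in> Red G A c" "xs @ [p', q'] @ ys \<in> Red G A c"
    using pq(1) pq'(1) hurwitz_orbit_subset red by auto
  have A: "set xs \<subseteq> A" "set [p, q] \<subseteq> A" "set [p', q'] \<subseteq> A" "set ys \<subseteq> A"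
    using RedD(1)[OF R(1)] RedD(1)[OF R(2)] by auto
  note cl = A[THEN word_carrier]
  have "word_prod G xs \<otimes> (word_prod G [p, q] \<otimes> word_prod G ys) =
      word_prod G xs \<otimes> (word_prod G [p', q'] \<otimes> word_prod G ys)"
    using RedD(2)[OF R(1)] RedD(2)[OF R(2)] A by (simp add: word_append del: append_Cons)
  then have g': "word_prod G [p', q'] = g"
    using cl by (simp add: g_def)
  note in1 = Red_infix[OF R(1), folded g_def] and in2 = Red_infix[OF R(2), unfolded g']
  have "[p, q] \<in> Red G A g" "[p', q'] \<in> Red G A g"
    using A in1 in2 g' by (auto simp: Red_def g_def)
  moreover have "\<exists>!s. [fst s, snd s] \<in> Red G A g \<and> s \<in> r"
    using r in1 cl(2) by (auto simp: compatible_order_def g_def)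
  ultimately have "(p, q) = (p', q')"
    using pq(2) pq'(2) by (metis fst_conv snd_conv)
  then have "xs @ p # q # ys \<in> hurwitz_orbit c (xs @ a' # b' # ys)" using pq'(1) by simp
  with pq(1) R red show ?thesis
    using H.orbit_trans H.orbit_sym by (metis append_Cons append_Nil)
qed

section \<open>From adjacent chains to transitivity\<close>

lemma hurwitz_orbit_adjacent:
  assumes fin: "finite (Red G A c)" and r: "compatible_order G A c r"
    and as: "as \<in> Red G A c" and bs: "bs \<in> Red G A c"
    and card: "card (prefix_prods as - prefix_prods bs) = 1"
  shows "bs \<in> hurwitz_orbit c as"
  using adjacent_prefix_prods[OF as bs card] hurwitz_orbit_rank_two[OF fin r] as bs by metis

lemma prefix_prods_inj:
  assumes as: "as \<in> Red G A c" and bs: "bs \<in> Red G A c" and eq: "prefix_prods as = prefix_prods bs"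
  shows "as = bs"
proof (rule nth_equalityI)
  show len: "length as = length bs" using RedD(3)[OF as] RedD(3)[OF bs] by simp
  have "word_prod G (take i as) = word_prod G (take i bs)" if "i \<le> length as" for i
    using take_prod_in_prefix_prods[OF as bs that] eq that by (auto simp: prefix_prods_def)
  then show "as ! i = bs ! i" if "i < length as" for i
    using that len nth_eq_prods[OF RedD(1)[OF as]] nth_eq_prods[OF RedD(1)[OF bs]] by simp
qed

text \<open>A path in the chain graph is followed: every vertex comes from a factorization, and no
  edge leaves the orbit by \<open>hurwitz_orbit_adjacent\<close>.\<close>

lemma hurwitz_orbit_chain_connected:
  assumes c: "c \<in> carrier G" and fin: "finite (Red G A c)" and r: "compatible_order G A c r"
    and conn: "chain_connected (factorization_poset G A c)"
    and as: "as \<in> Red G A c" and bs: "bs \<in> Red G A c"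
  shows "bs \<in> hurwitz_orbit c as"
proof -
  interpret H: group_action "braid_group (wlen G A c)" "Red G A c" "hurwitz_action G A c"
    by (rule Red_group_action)
  let ?D = "with_proj (chain_graph (factorization_poset G A c))"
  have verts: "pverts (chain_graph (factorization_poset G A c)) = {C. maxchain_below c C}"
    by (simp add: chain_graph_def)
  \<comment> \<open>Connectedness of a digraph is strong connectedness of its
    symmetrization.\<close>
  have "prefix_prods as \<rightarrow>\<^sup>*\<^bsub>with_proj (mk_symmetric ?D)\<^esub> prefix_prods bs"
    using conn maxchain_prefix_prods[OF as] maxchain_prefix_prods[OF bs]
    unfolding chain_connected_def Digraph_Component.connected_def strongly_connected_def
    by (simp add: verts)
  then have "(prefix_prods as, prefix_prods bs) \<in>
      rtrancl_on {C. maxchain_below c C} (parcs (mk_symmetric ?D))"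
    unfolding reachable_def by (simp add: verts)
  \<comment> \<open>The path runs through sets, so the invariant ranges over all factorizations with
    a given chain; \<open>prefix_prods_inj\<close> settles the start.\<close>
  then have "\<forall>ds \<in> Red G A c. prefix_prods ds = prefix_prods bs \<longrightarrow> ds \<in> hurwitz_orbit c as"
  proof (induction rule: rtrancl_on_induct)
    case base
    then show ?case using prefix_prods_inj[OF as] H.orbit_refl as by blast
  next
    case (step C D)
    obtain cs where cs: "cs \<in> Red G A c" "C = prefix_prods cs"
      using step c maxchain_is_prefix_prods by blast
    \<comment> \<open>The arc may come from either orientation; \<open>chain_graph\<close> bounds
      both differences.\<close>
    have "card (C - D) = 1"
      using step.hyps(2) by (auto simp: parcs_mk_symmetric chain_graph_def)
    then show ?case
      using hurwitz_orbit_adjacent[OF fin r cs(1)] cs step.IH H.orbit_trans as by blast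
  qed
  with bs show ?thesis by blast
qed

end

theorem theorem1p2:
  fixes G :: "('a, 'b) monoid_scheme" (structure)
    and A :: "'a set" and c :: 'a and n :: nat
  assumes "group G"
    and "A \<subseteq> carrier G"
    and "monoid_generated G A = carrier G"
    and "\<forall>g \<in> carrier G. \<forall>a \<in> A. g \<otimes> a \<otimes> inv g \<in> A"
    and "c \<in> carrier G"
    and "n = wlen G A c"
    and "finite (Red G A c)"
    and "chain_connected (factorization_poset G A c)"
    and "\<exists>r. compatible_order G A c r"
  shows "transitive_action (braid_group n) (Red G A c) (hurwitz_action G A c)"
proof -
  interpret group G by (rule assms(1))
  interpret conj_generated_group G A
    by unfold_locales (use assms in auto)
  from assms(9) obtain r where r: "compatible_order G A c r" ..
  show ?thesis
    unfolding assms(6)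
  proof (intro transitive_action.intro transitive_action_axioms.intro Red_group_action)
    fix as bs assume "as \<in> Red G A c" "bs \<in> Red G A c"
    then have "bs \<in> hurwitz_orbit c as"
      by (rule hurwitz_orbit_chain_connected[OF assms(5,7) r assms(8)])
    then show "\<exists>\<beta> \<in> carrier (braid_group (wlen G A c)). hurwitz_action G A c \<beta> as = bs"
      by (auto simp: orbit_def)
  qed
qed

end
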